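(* Let $(X,\mathcal{B})$ be a primitive uniform space, and let $f\colon X\to X$ be a nonexpansive mapping. Assume that $\emptyset\neq Y\subset X$ is such that $f(Y)\subset Y$. If $x\in c_{\mathcal{B}}(f_{\mid Y})$, then $f(x)\in c_{\mathcal{B}}(f_{\mid Y})$, and $x$ is a fixed point of $f$ (i.e. $f(x)=x$) provided that $c_{\mathcal{B}}(f_{\mid Y})$ is a singleton.
   Context: A primitive uniform space is a pair $(X,\mathcal{B})$, where $X$ is a nonempty set and $\mathcal{B}$ is a family of subsets of $X\times X$ such that $X\times X\in\mathcal{B}$ (no other condition is imposed on $\mathcal{B}$). For $B\in\mathcal{B}$, $x\in X$ and $A\subset X$ write $B(x)=\{y\in X:(x,y)\in B\}$ and $B(A)=\bigcup_{a\in A}B(a)$. A (multivalued) mapping $F\colon Y\to 2^{Y}$ assigns to each $y\in Y$ a nonempty subset $F(y)\subset Y$; $F(A)=\bigcup_{a\in A}F(a)$ and $F^{n}(Y)$ denotes the $n$-th iterated image of $Y$ under $F$, $n\in\mathbb{N}$. A single-valued mapping $f$ is identified with $y\mapsto\{f(y)\}$. A mapping $F\colon X\to 2^{X}$ is nonexpansive if $F(B(x))\subset B(F(x))$ for all $x\in X$ and $B\in\mathcal{B}$; thus a single-valued $f\colon X\to X$ is nonexpansive if $f(B(x))\subset B(f(x))$ for all $x\in X$, $B\in\mathcal{B}$. Let $\emptyset\neq Y\subset X$ and let $F\colon Y\to 2^{Y}$ be a mapping. A point $x\in X$ is a central point for $F$ if $$\bigcap\{B\in\mathcal{B}: F^{n}(Y)\subset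 B(z)\text{ for some } n\in\mathbb{N}\text{ and some } z\in X\}=\bigcap\{B\in\mathcal{B}: F^{n}(Y)\subset B(x)\text{ for some } n\in\mathbb{N}\}.$$ The centre $c_{\mathcal{B}}(F)$ of $F$ is the set of all central points for $F$. Here $f_{\mid Y}$ is the restriction of $f$ to $Y$, regarded as a mapping of $Y$ into $Y$. *)

theory Defs
  imports Main "HOL-Library.FuncSet"
begin

definition primitive_uniform_space :: "'a set \<Rightarrow> ('a \<times> 'a) set set \<Rightarrow> bool" where
  "primitive_uniform_space X \<B> \<longleftrightarrow> X \<noteq> {} \<and> (\<forall>B\<in>\<B>. B \<subseteq> X \<times> X) \<and> X \<times> X \<in> \<B>"

text \<open>
  Since every \<open>B \<in> \<B>\<close> is a subset of \<open>X \<times> X\<close>, the sets \<open>B(x) = {y \<in> X. (x, y) \<in> B}\<close> and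
  \<open>B(A) = (\<Union>a\<in>A. B(a))\<close> are the relational images \<open>B `` {x}\<close> and \<open>B `` A\<close>.
\<close>

text \<open>\<open>F : Y \<rightarrow> 2\<^sup>Y\<close> with nonempty values; the values of \<open>F\<close> outside \<open>Y\<close> are irrelevant.\<close>

definition multivalued_self_map :: "'a set \<Rightarrow> ('a \<Rightarrow> 'a set) \<Rightarrow> bool" where
  "multivalued_self_map Y F \<longleftrightarrow> (\<forall>y\<in>Y. F y \<noteq> {} \<and> F y \<subseteq> Y)"

definition multi_image :: "('a \<Rightarrow> 'a set) \<Rightarrow> 'a set \<Rightarrow> 'a set" where
  "multi_image F A = (\<Union>a\<in>A. F a)"

definition single_valued_map :: "('a \<Rightarrow> 'a) \<Rightarrow> 'a \<Rightarrow> 'a set" where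
  "single_valued_map f = (\<lambda>x. {f x})"

definition nonexpansive :: "'a set \<Rightarrow> ('a \<times> 'a) set set \<Rightarrow> ('a \<Rightarrow> 'a set) \<Rightarrow> bool" where
  "nonexpansive X \<B> F \<longleftrightarrow>
     multivalued_self_map X F \<and>
     (\<forall>x\<in>X. \<forall>B\<in>\<B>. multi_image F (B `` {x}) \<subseteq> B `` F x)"

text \<open>
  The domain \<open>Y\<close> of \<open>F : Y \<rightarrow> 2\<^sup>Y\<close> is an explicit argument. Neither intersection is over an empty
  family when \<open>Y \<subseteq> X\<close> and \<open>x \<in> X\<close>, because \<open>X \<times> X \<in> \<B>\<close>. The iterated images of \<open>Y\<close> decrease,
  so it makes no difference whether the exponents \<open>n\<close> start at 0 or at 1.
\<close>

definition central_point ::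
  "'a set \<Rightarrow> ('a \<times> 'a) set set \<Rightarrow> 'a set \<Rightarrow> ('a \<Rightarrow> 'a set) \<Rightarrow> 'a \<Rightarrow> bool" where
  "central_point X \<B> Y F x \<longleftrightarrow>
     x \<in> X \<and>
     \<Inter>{B \<in> \<B>. \<exists>n. \<exists>z\<in>X. (multi_image F ^^ n) Y \<subseteq> B `` {z}} =
     \<Inter>{B \<in> \<B>. \<exists>n. (multi_image F ^^ n) Y \<subseteq> B `` {x}}"

definition centre ::
  "'a set \<Rightarrow> ('a \<times> 'a) set set \<Rightarrow> 'a set \<Rightarrow> ('a \<Rightarrow> 'a set) \<Rightarrow> 'a set" where
  "centre X \<B> Y F = {x. central_point X \<B> Y F x}"

end

theory Submission
  imports Defs
begin

text \<open>
  Call \<open>B \<in> \<B>\<close> admissible at \<open>z\<close> if some iterated image of \<open>Y\<close> lies in \<open>B(z)\<close>. A point is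
  central if the relations admissible at it have the same intersection as those admissible anywhere.
  A nonexpansive \<open>f\<close> preserves admissibility along orbits: applying \<open>f\<close> to
  \<open>f\<^sup>n(Y) \<subseteq> B(x)\<close> gives \<open>f\<^sup>n\<^sup>+\<^sup>1(Y) \<subseteq> f(B(x)) \<subseteq> B(f(x))\<close>. So the family of relations admissible at
  \<open>f(x)\<close> lies between the family at \<open>x\<close> and the family of all admissible relations. If \<open>x\<close> is
  central, the two outer families have the same intersection, hence so does the middle one, and
  \<open>f(x)\<close> is central. The centre is thus mapped into itself by \<open>f\<close>; when it is a singleton, its
  only point is fixed.
\<close>

lemma multi_image_single_valued_restrict:
  assumes "A \<subseteq> Y"
  shows "multi_image (single_valued_map (restrict f Y)) A = f ` A"
proof -
  have "multi_image (single_valued_map (restrict f Y)) A = restrict f Y ` A"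
    unfolding multi_image_def single_valued_map_def by blast
  also have "\<dots> = f ` A"
    using assms by (intro image_cong) auto
  finally show ?thesis .
qed

lemma multi_image_single_valued_iterate_subset:
  assumes "f ` Y \<subseteq> Y"
  shows "(multi_image (single_valued_map (restrict f Y)) ^^ n) Y \<subseteq> Y"
proof (induction n)
  case (Suc n)
  have "(multi_image (single_valued_map (restrict f Y)) ^^ Suc n) Y =
      f ` (multi_image (single_valued_map (restrict f Y)) ^^ n) Y"
    unfolding funpow.simps comp_apply using Suc by (rule multi_image_single_valued_restrict)
  also have "\<dots> \<subseteq> Y"
    using Suc assms by blast
  finally show ?case .
qed simp

lemma nonexpansive_single_valued_image:
  assumes "nonexpansive X \<B> (single_valued_map f)" and "x \<in> X" and "B \<in> \<B>"
  shows "f ` (B `` {x}) \<subseteq> B `` {f x}"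
proof -
  have "multi_image (single_valued_map f) (B `` {x}) \<subseteq> B `` single_valued_map f x"
    using assms by (simp add: nonexpansive_def)
  then show ?thesis
    by (auto simp: multi_image_def single_valued_map_def)
qed

text \<open>
  The family of relations admissible at \<open>z\<close> is sandwiched between the family at the central point
  \<open>x\<close> and the family of all admissible relations, so all three have the same intersection.
\<close>

lemma central_point_transfer:
  assumes central: "central_point X \<B> Y F x" and z: "z \<in> X"
    and transfer: "\<And>B n. B \<in> \<B> \<Longrightarrow> (multi_image F ^^ n) Y \<subseteq> B `` {x} \<Longrightarrow>
      \<exists>m. (multi_image F ^^ m) Y \<subseteq> B `` {z}"
  shows "central_point X \<B> Y F z"
proof -
  let ?all = "{B \<in> \<B>. \<exists>n. \<exists>w\<in>X. (multi_image F ^^ n) Y \<subseteq> B `` {w}}"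
  let ?at = "\<lambda>w. {B \<in> \<B>. \<exists>n. (multi_image F ^^ n) Y \<subseteq> B `` {w}}"
  have "?at x \<subseteq> ?at z"
    using transfer by blast
  then have "\<Inter>(?at z) \<subseteq> \<Inter>(?at x)"
    by (rule Inter_anti_mono)
  moreover have "\<Inter>(?at x) = \<Inter>?all"
    using central by (simp add: central_point_def)
  moreover have "?at z \<subseteq> ?all"
    using z by blast
  then have "\<Inter>?all \<subseteq> \<Inter>(?at z)"
    by (rule Inter_anti_mono)
  ultimately have "\<Inter>?all = \<Inter>(?at z)"
    by order
  then show ?thesis
    using z by (simp add: central_point_def)
qed

lemma nonexpansive_image_central_point:
  assumes nonexp: "nonexpansive X \<B> (single_valued_map f)" and f: "f \<in> X \<rightarrow> X"
    and Y: "f ` Y \<subseteq> Y"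
    and central: "central_point X \<B> Y (single_valued_map (restrict f Y)) x"
  shows "central_point X \<B> Y (single_valued_map (restrict f Y)) (f x)"
proof -
  let ?F = "single_valued_map (restrict f Y)"
  have x: "x \<in> X"
    using central by (simp add: central_point_def)
  have step: "\<exists>m. (multi_image ?F ^^ m) Y \<subseteq> B `` {f x}"
    if B: "B \<in> \<B>" and sub: "(multi_image ?F ^^ n) Y \<subseteq> B `` {x}" for B n
  proof
    have "(multi_image ?F ^^ Suc n) Y = f ` (multi_image ?F ^^ n) Y"
      unfolding funpow.simps comp_apply
      using multi_image_single_valued_iterate_subset[OF Y]
      by (rule multi_image_single_valued_restrict)
    also have "\<dots> \<subseteq> f ` (B `` {x})"
      using sub by (rule image_mono)
    also have "\<dots> \<subseteq> B `` {f x}"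
      using nonexp x B by (rule nonexpansive_single_valued_image)
    finally show "(multi_image ?F ^^ Suc n) Y \<subseteq> B `` {f x}" .
  qed
  show ?thesis
  proof (rule central_point_transfer[OF central])
    show "f x \<in> X"
      using f x by blast
  qed (rule step)
qed

theorem theorem6:
  fixes X Y :: "'a set" and \<B> :: "('a \<times> 'a) set set" and f :: "'a \<Rightarrow> 'a" and x :: 'a
  assumes "primitive_uniform_space X \<B>"
    and "f \<in> X \<rightarrow> X"
    and "nonexpansive X \<B> (single_valued_map f)"
    and "Y \<noteq> {}" and "Y \<subseteq> X" and "f ` Y \<subseteq> Y"
    and "x \<in> centre X \<B> Y (single_valued_map (restrict f Y))"
  shows "f x \<in> centre X \<B> Y (single_valued_map (restrict f Y)) \<and>
    (is_singleton (centre X \<B> Y (single_valued_map (restrict f Y))) \<longrightarrow> f x = x)"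
proof -
  let ?C = "centre X \<B> Y (single_valued_map (restrict f Y))"
  have "f x \<in> ?C"
    using nonexpansive_image_central_point[OF assms(3,2,6)] assms(7)
    by (simp add: centre_def)
  moreover have "f x = x" if "is_singleton ?C"
    using that \<open>f x \<in> ?C\<close> assms(7) by (auto elim: is_singletonE)
  ultimately show ?thesis
    by blast
qed

end
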